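(* Let $\mathcal{J}\subseteq\mathrm{Sym}_\Omega(\mathbb{R})$ be a subspace of real symmetric matrices closed under the Jordan product $A\star B=\frac12(AB+BA)$, and suppose $(\mathcal{J},\star)$ is isomorphic as a Jordan algebra to $\mathbb{R}\oplus\mathbb{R}\oplus\mathrm{Sym}_2(\mathbb{R})$. Then the subalgebra of $M_\Omega(\mathbb{R})$ generated by $\mathcal{J}$ under the ordinary matrix product is isomorphic to $\mathbb{R}\oplus\mathbb{R}\oplus M_2(\mathbb{R})$.
   Context: $\mathrm{Sym}_\Omega(\mathbb{R})$ is the space of real symmetric matrices indexed by $\Omega$; $\mathrm{Sym}_2(\mathbb{R})$ denotes the real symmetric $2\times2$ matrices with product $X\star Y=\frac12(XY+YX)$; $M_2(\mathbb{R})$ is the associative algebra of real $2\times2$ matrices. *)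

theory Defs
  imports "HOL-Analysis.Analysis"
begin

definition Sym :: "(real ^ 'n ^ 'n) set" where
  "Sym = {A. transpose A = A}"

definition jordan_prod :: "real ^ 'n ^ 'n \<Rightarrow> real ^ 'n ^ 'n \<Rightarrow> real ^ 'n ^ 'n"
    (infixl "\<star>" 70) where
  "A \<star> B = (1 / 2) *\<^sub>R (A ** B + B ** A)"

definition dsum_prod ::
    "('a \<Rightarrow> 'a \<Rightarrow> 'a) \<Rightarrow> ('b \<Rightarrow> 'b \<Rightarrow> 'b) \<Rightarrow> 'a \<times> 'b \<Rightarrow> 'a \<times> 'b \<Rightarrow> 'a \<times> 'b" where
  "dsum_prod p q x y = (p (fst x) (fst y), q (snd x) (snd y))"

text \<open>A real algebra, associative or not, is given by a carrier \<open>S\<close> (a subspace of the ambient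
  type) and a product \<open>p\<close>, of which only the restriction to \<open>S\<close> matters. Likewise an isomorphism
  is constrained only on the carrier. Units need not be mentioned: a multiplicative
  bijection preserves a unit whenever one exists.\<close>

definition algebra_isomorphic ::
    "'a::real_vector set \<Rightarrow> ('a \<Rightarrow> 'a \<Rightarrow> 'a) \<Rightarrow> 'b::real_vector set \<Rightarrow> ('b \<Rightarrow> 'b \<Rightarrow> 'b) \<Rightarrow> bool" where
  "algebra_isomorphic S p T q \<longleftrightarrow>
    (\<exists>f. bij_betw f S T \<and>
      (\<forall>x\<in>S. \<forall>y\<in>S. f (x + y) = f x + f y) \<and>
      (\<forall>c. \<forall>x\<in>S. f (c *\<^sub>R x) = c *\<^sub>R f x) \<and>
      (\<forall>x\<in>S. \<forall>y\<in>S. f (p x y) = q (f x) (f y)))"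

text \<open>Subalgebras are not required to contain the identity matrix: \<open>J\<close> may have a unit
  different from \<open>mat 1\<close>. If \<open>mat 1 \<in> J\<close>, this agrees with the unital notion.\<close>

definition generated_subalgebra :: "(real ^ 'n ^ 'n) set \<Rightarrow> (real ^ 'n ^ 'n) set" where
  "generated_subalgebra J =
    (\<lambda>S. subspace S \<and> (\<forall>A\<in>S. \<forall>B\<in>S. A ** B \<in> S)) hull J"

end

theory Submission
  imports Defs
begin

text \<open>Let \<open>E\<close>, \<open>F\<close>, \<open>S\<close> correspond to \<open>e\<^sub>1\<^sub>1\<close>, \<open>e\<^sub>2\<^sub>2\<close>, \<open>e\<^sub>1\<^sub>2 + e\<^sub>2\<^sub>1\<close>, and let \<open>P\<close>, \<open>Q\<close> be the units of the two
  copies of \<open>\<real>\<close>. If an idempotent \<open>A\<close> satisfies \<open>AB + BA = 0\<close>, then \<open>AB = BA = 0\<close>, so \<open>P\<close>, \<open>Q\<close> and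
  the triple \<open>E, F, S\<close> annihilate one another in the associative product as well. The Peirce
  relations \<open>ES + SE = S = FS + SF\<close> and \<open>S\<^sup>2 = E + F\<close> make \<open>E, ES, SE, F\<close> a system of \<open>2 \<times> 2\<close> matrix
  units, which spans a copy of \<open>M\<^sub>2(\<real>)\<close> because \<open>E\<close> and \<open>F\<close> are nonzero.\<close>

section \<open>Bilinearity of the matrix product and Jordan products with idempotents\<close>

lemma matrix_add_rdistrib: "(B + C) ** A = B ** A + C ** A"
  by (vector matrix_matrix_mult_def sum.distrib[symmetric] field_simps)

lemma scaleR_matrix_assoc: "(k *\<^sub>R A) ** B = k *\<^sub>R (A ** B)" for A :: "real ^ 'm ^ 'n"
  by (simp add: scalar_matrix_assoc)

lemma matrix_scaleR_ac: "A ** (k *\<^sub>R B) = k *\<^sub>R (A ** B)" for A :: "real ^ 'm ^ 'n"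
  by (simp add: matrix_scalar_ac scalar_matrix_assoc)

lemmas matrix_bilinear_simps =
  matrix_add_ldistrib matrix_add_rdistrib scaleR_matrix_assoc matrix_scaleR_ac

lemma jordan_prod_self: "A \<star> A = A ** A"
  by (simp add: jordan_prod_def flip: scaleR_2)

lemma jordan_prod_eq_iff: "A \<star> B = C \<longleftrightarrow> A ** B + B ** A = 2 *\<^sub>R C"
  by (auto simp: jordan_prod_def)

text \<open>Multiplying \<open>A ** B + B ** A = 0\<close> by \<open>A\<close> on the left and on
  the right gives two sums sharing the term \<open>A ** B ** A\<close>. Cancelling it leaves
  \<open>A ** B = B ** A\<close>, and then the sum forces both to vanish.\<close>

lemma idempotent_jordan_orthogonal:
  assumes "A ** A = A" and "A \<star> B = 0"
  shows "A ** B = 0" and "B ** A = 0"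
proof -
  have sum: "A ** B + B ** A = 0"
    using assms(2) by (simp add: jordan_prod_eq_iff)
  have "A ** (A ** B + B ** A) = A ** B + A ** B ** A"
    by (simp add: matrix_bilinear_simps matrix_mul_assoc assms(1))
  moreover have "(A ** B + B ** A) ** A = A ** B ** A + B ** A"
    by (simp add: matrix_bilinear_simps assms(1) flip: matrix_mul_assoc)
  ultimately have eq: "A ** B = B ** A"
    unfolding sum by (simp add: eq_neg_iff_add_eq_0 add.commute) (metis add.commute add_right_cancel)
  with sum have "2 *\<^sub>R (A ** B) = 0"
    by (simp add: scaleR_2)
  with eq show "A ** B = 0" "B ** A = 0" by simp_all
qed

text \<open>The natural map goes from the abstract algebra into the matrices, so the required
  isomorphism is its inverse.\<close>

lemma algebra_isomorphic_range:
  fixes f :: "'b::real_vector \<Rightarrow> 'a::real_vector"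
  assumes "linear f" and "inj f" and "\<And>x y. f (q x y) = p (f x) (f y)"
  shows "algebra_isomorphic (range f) p UNIV q"
  unfolding algebra_isomorphic_def
proof (intro exI conjI)
  show "bij_betw (inv f) (range f) UNIV"
    using assms(2) by (simp add: bij_betw_inv_into inj_on_imp_bij_betw)
qed (auto simp: inv_f_f[OF assms(2)]
    simp flip: linear_add[OF assms(1)] linear_scale[OF assms(1)] assms(3))

lemma mat2_eq_iff: "A = B \<longleftrightarrow>
    A $ 1 $ 1 = B $ 1 $ 1 \<and> A $ 1 $ 2 = B $ 1 $ 2 \<and> A $ 2 $ 1 = B $ 2 $ 1 \<and> A $ 2 $ 2 = B $ 2 $ 2"
  for A B :: "'a ^ 2 ^ 2"
  by (auto simp: vec_eq_iff forall_2)

text \<open>The Jordan multiplication table of the standard basis. Squares are written with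
  \<open>**\<close>, since Jordan squares and ordinary squares coincide.\<close>

locale jordan_system =
  fixes P Q E F S :: "real ^ 'n ^ 'n"
  assumes P: "P ** P = P" "P \<star> Q = 0" "P \<star> E = 0" "P \<star> F = 0" "P \<star> S = 0"
    and Q: "Q ** Q = Q" "Q \<star> E = 0" "Q \<star> F = 0" "Q \<star> S = 0"
    and E: "E ** E = E" "E \<star> F = 0" "E \<star> S = (1 / 2) *\<^sub>R S"
    and F: "F ** F = F" "F \<star> S = (1 / 2) *\<^sub>R S"
    and S: "S ** S = E + F"
    and nonzero: "P \<noteq> 0" "Q \<noteq> 0" "E \<noteq> 0" "F \<noteq> 0"
begin

lemmas annihilate =
  idempotent_jordan_orthogonal[OF P(1) P(2)] idempotent_jordan_orthogonal[OF P(1) P(3)]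
  idempotent_jordan_orthogonal[OF P(1) P(4)] idempotent_jordan_orthogonal[OF P(1) P(5)]
  idempotent_jordan_orthogonal[OF Q(1) Q(2)] idempotent_jordan_orthogonal[OF Q(1) Q(3)]
  idempotent_jordan_orthogonal[OF Q(1) Q(4)] idempotent_jordan_orthogonal[OF E(1) E(2)]

section \<open>Associative relations forced by the Jordan relations\<close>

lemma peirce: "E ** S + S ** E = S" "F ** S + S ** F = S"
  using E(3) F(2) by (simp_all add: jordan_prod_eq_iff)

lemma ESE: "E ** S ** E = 0"
proof -
  \<comment> \<open>Expanding with \<open>E ** E = E\<close> produces \<open>E ** S\<close> on both
    sides, and only \<open>E ** S ** E\<close> is left over.\<close>
  have "E ** (E ** S + S ** E) = E ** S"
    by (simp only: peirce)
  then show ?thesis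
    by (simp add: matrix_bilinear_simps matrix_mul_assoc E)
qed

lemma SE: "S ** E = F ** S" and ES: "E ** S = S ** F"
proof -
  have "(F ** S + S ** F) ** E = S ** E" "F ** (E ** S + S ** E) = F ** S"
    "E ** (F ** S + S ** F) = E ** S" "(E ** S + S ** E) ** F = S ** F"
    by (simp_all only: peirce)
  \<comment> \<open>One term of each expansion contains \<open>E ** F\<close> or
    \<open>F ** E\<close>, hence vanishes. Left bracketing exposes this factor at the front, right
    bracketing at the end.\<close>
  then have "F ** S ** E = S ** E" "F ** S ** E = F ** S" "E ** S ** F = E ** S" "E ** S ** F = S ** F"
    by (simp_all add: matrix_bilinear_simps matrix_mul_assoc annihilate)
      (simp_all add: annihilate flip: matrix_mul_assoc)
  then show "S ** E = F ** S" "E ** S = S ** F" by simp_all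
qed

lemma matrix_units:
  "E ** (E ** S) = E ** S" "(E ** S) ** E = 0"
  "E ** (S ** E) = 0" "(S ** E) ** E = S ** E"
  "F ** (E ** S) = 0" "(E ** S) ** F = E ** S"
  "F ** (S ** E) = S ** E" "(S ** E) ** F = 0"
  "(E ** S) ** (E ** S) = 0" "(S ** E) ** (S ** E) = 0"
  "(E ** S) ** (S ** E) = E" "(S ** E) ** (E ** S) = F"
proof -
  show "E ** (E ** S) = E ** S" "(E ** S) ** E = 0"
    "E ** (S ** E) = 0" "F ** (E ** S) = 0"
    "(E ** S) ** (E ** S) = 0"
    by (simp_all add: matrix_mul_assoc E F annihilate ESE)
  show "(S ** E) ** E = S ** E" "(S ** E) ** F = 0"
    by (simp_all add: E annihilate flip: matrix_mul_assoc)
  show "(E ** S) ** F = E ** S"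
    by (simp add: ES F flip: matrix_mul_assoc)
  show "F ** (S ** E) = S ** E"
    by (simp add: SE F matrix_mul_assoc)
  show "(S ** E) ** (S ** E) = 0"
    by (metis ESE matrix_mul_assoc times0_right)
  have "(E ** S) ** (S ** E) = E ** (S ** S) ** E"
    by (simp add: matrix_mul_assoc)
  then show "(E ** S) ** (S ** E) = E"
    by (simp add: S matrix_bilinear_simps E annihilate)
  \<comment> \<open>Moving the idempotents outwards puts \<open>S ** S = E + F\<close> between two
    copies of \<open>F\<close>.\<close>
  have "(S ** E) ** (E ** S) = (F ** S) ** (S ** F)"
    by (simp add: ES SE)
  also have "\<dots> = F ** (S ** S) ** F"
    by (simp add: matrix_mul_assoc)
  finally show "(S ** E) ** (E ** S) = F"
    by (simp add: S matrix_bilinear_simps F annihilate)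
qed

section \<open>The embedding with \<open>E\<close>, \<open>E ** S\<close>, \<open>S ** E\<close>,
  \<open>F\<close> as matrix units\<close>

definition rep :: "real \<times> real \<times> (real ^ 2 ^ 2) \<Rightarrow> real ^ 'n ^ 'n" where
  "rep x = fst x *\<^sub>R P + fst (snd x) *\<^sub>R Q
    + (snd (snd x) $ 1 $ 1 *\<^sub>R E + snd (snd x) $ 1 $ 2 *\<^sub>R (E ** S)
      + snd (snd x) $ 2 $ 1 *\<^sub>R (S ** E) + snd (snd x) $ 2 $ 2 *\<^sub>R F)"

lemma linear_rep: "linear rep"
  by (rule linearI) (simp_all add: rep_def algebra_simps)

lemma summands_annihilate:
  "P ** (E ** S) = 0" "P ** (S ** E) = 0" "(E ** S) ** P = 0" "(S ** E) ** P = 0"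
  "Q ** (E ** S) = 0" "Q ** (S ** E) = 0" "(E ** S) ** Q = 0" "(S ** E) ** Q = 0"
  by (simp_all add: matrix_mul_assoc annihilate) (simp_all add: annihilate flip: matrix_mul_assoc)

lemma rep_mult: "rep (dsum_prod (*) (dsum_prod (*) (**)) x y) = rep x ** rep y"
  by (simp add: rep_def dsum_prod_def matrix_bilinear_simps matrix_units summands_annihilate
      annihilate P(1) Q(1) E(1) F(1) matrix_matrix_mult_def[of "_ :: real ^ 2 ^ 2"] sum_2 algebra_simps)

lemma inj_rep: "inj rep"
proof -
  have "x = 0" if "rep x = 0" for x
  proof -
    obtain a b M where x: "x = (a, b, M)" by (cases x) auto
    \<comment> \<open>Each product isolates one coefficient. The right factors \<open>S ** E\<close>
      and \<open>E ** S\<close> move the off-diagonal entries onto the diagonal, where they multiply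
      the nonzero \<open>E\<close> and \<open>F\<close>.\<close>
    have "P ** rep x = a *\<^sub>R P" "Q ** rep x = b *\<^sub>R Q"
      "E ** rep x ** E = (M $ 1 $ 1) *\<^sub>R E" "F ** rep x ** F = (M $ 2 $ 2) *\<^sub>R F"
      "E ** rep x ** (S ** E) = (M $ 1 $ 2) *\<^sub>R E" "F ** rep x ** (E ** S) = (M $ 2 $ 1) *\<^sub>R F"
      by (simp_all add: x rep_def matrix_bilinear_simps matrix_units summands_annihilate
          annihilate P(1) Q(1) E(1) F(1))
    then have "a = 0" "b = 0" "M = 0"
      using that nonzero by (simp_all add: mat2_eq_iff)
    then show "x = 0" by (simp add: x zero_prod_def)
  qed
  then show ?thesis
    by (simp add: linear_injective_0 linear_rep)
qed

lemma generated_subalgebra_eq_range: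
  assumes "J \<subseteq> range rep" and "{P, Q, E, F, S} \<subseteq> J"
  shows "generated_subalgebra J = range rep"
  unfolding generated_subalgebra_def
proof (rule hull_unique[OF assms(1)])
  show "subspace (range rep) \<and> (\<forall>A\<in>range rep. \<forall>B\<in>range rep. A ** B \<in> range rep)"
    by (auto simp: linear_subspace_image linear_rep simp flip: rep_mult)
  fix T assume T: "J \<subseteq> T" "subspace T \<and> (\<forall>A\<in>T. \<forall>B\<in>T. A ** B \<in> T)"
  then have "P \<in> T" "Q \<in> T" "E \<in> T" "F \<in> T" "E ** S \<in> T" "S ** E \<in> T"
    using assms(2) by auto
  with T show "range rep \<subseteq> T"
    by (auto simp: rep_def intro!: subspace_add subspace_scale)
qed

lemma algebra_isomorphic_rep:
  "algebra_isomorphic (range rep) (**) UNIV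
    (dsum_prod ((*) :: real \<Rightarrow> real \<Rightarrow> real) (dsum_prod ((*) :: real \<Rightarrow> real \<Rightarrow> real)
      ((**) :: real ^ 2 ^ 2 \<Rightarrow> real ^ 2 ^ 2 \<Rightarrow> real ^ 2 ^ 2)))"
  by (intro algebra_isomorphic_range linear_rep inj_rep) (rule rep_mult)

end

theorem theorem3p5:
  fixes J :: "(real ^ 'n ^ 'n) set"
  assumes "subspace J"
    and "J \<subseteq> Sym"
    and "\<And>A B. A \<in> J \<Longrightarrow> B \<in> J \<Longrightarrow> A \<star> B \<in> J"
    and "algebra_isomorphic
           J (\<star>)
           (UNIV \<times> UNIV \<times> (Sym :: (real ^ 2 ^ 2) set))
           (dsum_prod ((*) :: real \<Rightarrow> real \<Rightarrow> real)
             (dsum_prod ((*) :: real \<Rightarrow> real \<Rightarrow> real) (\<star>)))"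
  shows "algebra_isomorphic
           (generated_subalgebra J) (**)
           (UNIV \<times> UNIV \<times> (UNIV :: (real ^ 2 ^ 2) set))
           (dsum_prod ((*) :: real \<Rightarrow> real \<Rightarrow> real)
             (dsum_prod ((*) :: real \<Rightarrow> real \<Rightarrow> real) (**)))"
proof -
  let ?T = "UNIV \<times> UNIV \<times> (Sym :: (real ^ 2 ^ 2) set)"
  let ?p = "dsum_prod ((*) :: real \<Rightarrow> real \<Rightarrow> real)
             (dsum_prod ((*) :: real \<Rightarrow> real \<Rightarrow> real) (\<star>))
             :: _ \<Rightarrow> _ \<Rightarrow> real \<times> real \<times> (real ^ 2 ^ 2)"
  from assms(4) obtain f where bij: "bij_betw f J ?T"
    and add: "\<And>x y. x \<in> J \<Longrightarrow> y \<in> J \<Longrightarrow> f (x + y) = f x + f y"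
    and scale: "\<And>c x. x \<in> J \<Longrightarrow> f (c *\<^sub>R x) = c *\<^sub>R f x"
    and mult: "\<And>x y. x \<in> J \<Longrightarrow> y \<in> J \<Longrightarrow> f (x \<star> y) = ?p (f x) (f y)"
    unfolding algebra_isomorphic_def by blast
  define g where "g = inv_into J f"
  have gJ: "g x \<in> J" and fg: "f (g x) = x" if "x \<in> ?T" for x
    using that bij_betw_inv_into[OF bij] bij_betw_inv_into_right[OF bij]
    by (auto simp: g_def bij_betw_def)
  have gf: "g (f A) = A" if "A \<in> J" for A
    using that bij_betw_inv_into_left[OF bij] by (simp add: g_def)
  have g_add: "g (x + y) = g x + g y" if "x \<in> ?T" "y \<in> ?T" for x y
    using that by (metis add fg gJ gf subspace_add[OF assms(1)])
  have g_scale: "g (c *\<^sub>R x) = c *\<^sub>R g x" if "x \<in> ?T" for c x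
    using that by (metis scale fg gJ gf subspace_scale[OF assms(1)])
  have g_mult: "g x \<star> g y = g (?p x y)" if "x \<in> ?T" "y \<in> ?T" for x y
    using that by (metis mult fg gJ gf assms(3))
  let ?sym = "\<lambda>p q r. vector [vector [p, q], vector [q, r]] :: real ^ 2 ^ 2"
  \<comment> \<open>Coordinates on \<open>J\<close>: all identities below reduce to real arithmetic
    in the two scalars and the upper triangle of the symmetric matrix.\<close>
  define k where "k a b p q r = g (a, b, ?sym p q r)" for a b p q r
  have sym: "?sym p q r \<in> Sym" for p q r
    by (simp add: Sym_def transpose_def mat2_eq_iff)
  \<comment> \<open>The fourth coordinate averages the (1,2) entries of the two ordinary
    products.\<close>
  have k_mult: "k a b p q r \<star> k a' b' p' q' r' = k (a * a') (b * b') (p * p' + q * q')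
      ((p * q' + q * r' + q * p' + r * q') / 2) (q * q' + r * r')" for a b p q r a' b' p' q' r'
  proof -
    have "?p (a, b, ?sym p q r) (a', b', ?sym p' q' r') = (a * a', b * b',
      ?sym (p * p' + q * q') ((p * q' + q * r' + q * p' + r * q') / 2) (q * q' + r * r'))"
      by (simp add: dsum_prod_def jordan_prod_def mat2_eq_iff matrix_matrix_mult_def sum_2 field_simps)
    then show ?thesis
      by (simp add: k_def sym g_mult)
  qed
  have k_add: "k a b p q r + k a' b' p' q' r' = k (a + a') (b + b') (p + p') (q + q') (r + r')"
    for a b p q r a' b' p' q' r'
  proof -
    have "?sym p q r + ?sym p' q' r' = ?sym (p + p') (q + q') (r + r')"
      by (simp add: mat2_eq_iff)
    then show ?thesis
      by (simp add: k_def sym flip: g_add)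
  qed
  have k_scale: "c *\<^sub>R k a b p q r = k (c * a) (c * b) (c * p) (c * q) (c * r)" for c a b p q r
  proof -
    have "c *\<^sub>R ?sym p q r = ?sym (c * p) (c * q) (c * r)"
      by (simp add: mat2_eq_iff)
    then show ?thesis
      by (simp add: k_def sym flip: g_scale)
  qed
  have k_zero: "k 0 0 0 0 0 = 0"
    using k_scale[of 0 0 0 0 0 0] by simp
  have k_nonzero: "k a b p q r \<noteq> 0" if "(a, b, p, q, r) \<noteq> (0, 0, 0, 0, 0)" for a b p q r
  proof
    assume "k a b p q r = 0"
    then have "f (k a b p q r) = f (k 0 0 0 0 0)" by (simp add: k_zero)
    then have "(a, b, ?sym p q r) = (0, 0, ?sym 0 0 0)"
      by (simp add: k_def fg sym)
    with that show False
      by (simp add: mat2_eq_iff)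
  qed
  interpret jordan_system "k 1 0 0 0 0" "k 0 1 0 0 0" "k 0 0 1 0 0" "k 0 0 0 0 1" "k 0 0 0 1 0"
    by (rule jordan_system.intro)
      (simp_all add: k_mult k_add k_scale k_zero k_nonzero flip: jordan_prod_self)
  have "J \<subseteq> range rep"
  proof
    fix A assume "A \<in> J"
    obtain a b M where f: "f A = (a, b, M)" by (cases "f A") auto
    have "transpose M = M"
      using bij_betw_apply[OF bij \<open>A \<in> J\<close>] f by (simp add: Sym_def)
    then have "transpose M $ 2 $ 1 = M $ 2 $ 1" by simp
    then have eq: "M $ 1 $ 2 = M $ 2 $ 1" by (simp add: transpose_def)
    then have M: "M = ?sym (M $ 1 $ 1) (M $ 1 $ 2) (M $ 2 $ 2)"
      by (simp add: mat2_eq_iff)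
    have "A = k a b (M $ 1 $ 1) (M $ 1 $ 2) (M $ 2 $ 2)"
      unfolding k_def M[symmetric] using gf[OF \<open>A \<in> J\<close>] f by simp
    also have "\<dots> = rep (a, b, M)"
    proof -
      \<comment> \<open>Symmetry of \<open>M\<close> gives both matrix units the same coefficient,
        and by \<open>peirce\<close> they add up to the element in the role of
        \<open>S\<close>.\<close>
      have "(M $ 1 $ 2) *\<^sub>R (k 0 0 1 0 0 ** k 0 0 0 1 0) + (M $ 2 $ 1) *\<^sub>R (k 0 0 0 1 0 ** k 0 0 1 0 0)
        = k 0 0 0 (M $ 1 $ 2) 0"
        using eq by (simp add: peirce k_scale flip: scaleR_add_right)
      moreover have "rep (a, b, M) = k a 0 0 0 0 + k 0 b 0 0 0 + (k 0 0 (M $ 1 $ 1) 0 0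
        + ((M $ 1 $ 2) *\<^sub>R (k 0 0 1 0 0 ** k 0 0 0 1 0)
          + (M $ 2 $ 1) *\<^sub>R (k 0 0 0 1 0 ** k 0 0 1 0 0)) + k 0 0 0 0 (M $ 2 $ 2))"
        by (simp add: rep_def k_scale add.assoc)
      ultimately show ?thesis
        by (simp add: k_add)
    qed
    finally show "A \<in> range rep" by simp
  qed
  moreover have "{k 1 0 0 0 0, k 0 1 0 0 0, k 0 0 1 0 0, k 0 0 0 0 1, k 0 0 0 1 0} \<subseteq> J"
    by (simp add: k_def gJ sym)
  ultimately have "generated_subalgebra J = range rep"
    by (rule generated_subalgebra_eq_range)
  with algebra_isomorphic_rep show ?thesis by simp
qed

end
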